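(* Let $Q \subseteq \mathbb{R}^n$ be a convex compact set and let $D>0$ satisfy $D \ge \max_{x,y\in Q}\|x-y\|$. Let $g: Q \to \mathbb{R}^n$, $g(x)=\mathbb{E}_\xi[g(x,\xi)]$, be a monotone operator that is H\"older continuous with constant $L_\nu$ for some exponent $\nu \in (0,1)$, i.e. $\|g(x)-g(y)\| \le L_\nu \|x-y\|^\nu$ for all $x,y \in Q$. Assume the unbiased stochastic operator $g(\cdot,\xi)$ has uniformly bounded variance: for some $\sigma>0$, $\mathbb{E}_\xi\left[\|g(x,\xi)-g(x)\|^2\right]\le\sigma^2$ for all $x\in Q$. Let $(z_k)$, $(w_k)$, $(L_k)$ be generated by the stochastic Universal Mirror Proximal Method (UMP) described in the context. For $k \ge 1$ put $\widehat{w} = \frac{1}{k+1}\sum_{i=0}^k w_i$. Then for every $k\ge1$ $$\mathbb{E}_\xi\left[\operatorname{Gap}(\widehat{w})\right] \le 32\left(\frac{D^2}{8k}\right)^{\frac{1+\nu}{2}} L_\nu + \frac{32 D}{\sqrt{8k}}\,\sigma + \frac{2D^2\, \mathbb{E}_\xi[L_0]}{k},$$ where $L_0$ is the initial value used by the algorithm (an initial guess of the H\"older constant).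
   Context: $\langle\cdot,\cdot\rangle$ and $\|\cdot\|$ are the standard inner product and Euclidean norm on $\mathbb{R}^n$. An operator $g:Q\to\mathbb{R}^n$ is monotone if $\langle g(x)-g(y),x-y\rangle\ge 0$ for all $x,y\in Q$; $g$ is continuous. The problem is the Minty variational inequality: find $x^*\in Q$ with $\langle g(x),x^*-x\rangle\le 0$ for all $x\in Q$. The gap (merit) function is $\operatorname{Gap}(\widehat{x}) = \max_{u\in Q}\langle g(u),\widehat{x}-u\rangle$. $\mathbb{E}_\xi$ outside a sampled trajectory denotes the full expectation over all the random samples used by the algorithm. Stochastic UMP. Inputs: a starting point $z_0=\arg\min_{u\in Q} d(u)\in Q$, where $d:Q\to\mathbb{R}$ is a given (prox) function having a minimizer on $Q$; the value $L_0=\|g(z_0,\xi_{z_0})\|$ for a generated random variable $\xi_{z_0}$; and the diameter bound $D>0$. For $k=0,1,2,\ldots$: 1. $w_k = \arg\min_{x\in Q}\left(\langle g(z_k,\xi_{z_k}),x-z_k\rangle+\frac{L_k}{2}\|z_k-x\|^2\right)$; 2. $z_{k+1} = \arg\min_{x\in Q}\left(\langle g(w_k,\xi_{w_k}),x-w_k\rangle+\frac{L_k}{2}\|z_k-x\|^2\right)$; 3. $L_{k+1} = L_k+\max\left\{0,\frac{2\langle g(w_k,\xi_{w_k}),w_k-z_{k+1}\rangle-L_k\|z_k-z_{k+1}\|^2}{D^2+\|z_k-z_{k+1}\|^2}\right\}$. Here $\xi_{z_k},\xi_{w_k}$ are fresh random samples of $\xi$, drawn independently of all earlier samples (in particular $\xi_{w_k}$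 is independent of $w_k$). The algorithm does not use $\nu$, $L_\nu$ or $\sigma$. Integer-indexed $L_k$ are the algorithm's values; $L_\nu$ with $\nu\in(0,1)$ is the H\"older constant. *)

theory Defs
  imports "HOL-Probability.Probability"
begin

definition monotone_operator_on ::
  "'a::real_inner set \<Rightarrow> ('a \<Rightarrow> 'a) \<Rightarrow> bool" where
  "monotone_operator_on Q g \<longleftrightarrow> (\<forall>x\<in>Q. \<forall>y\<in>Q. (g x - g y) \<bullet> (x - y) \<ge> 0)"

definition hoelder_on ::
  "'a::real_normed_vector set \<Rightarrow> real \<Rightarrow> real \<Rightarrow> ('a \<Rightarrow> 'b::real_normed_vector) \<Rightarrow> bool" where
  "hoelder_on Q \<nu> C g \<longleftrightarrow>
     0 \<le> C \<and> (\<forall>x\<in>Q. \<forall>y\<in>Q. norm (g x - g y) \<le> C * norm (x - y) powr \<nu>)"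

text \<open>For compact nonempty \<open>Q\<close> and continuous \<open>g\<close> the supremum is a maximum.\<close>

definition Gap :: "'a::real_inner set \<Rightarrow> ('a \<Rightarrow> 'a) \<Rightarrow> 'a \<Rightarrow> real" where
  "Gap Q g x = (SUP u\<in>Q. g u \<bullet> (x - u))"

text \<open>
  \<open>G x y\<close> is the stochastic operator at the point \<open>x\<close> and the sample \<open>y\<close>; \<open>S\<close> is the law
  of a sample. Measurability in both arguments makes \<open>G (z \<omega>) (\<xi> \<omega>)\<close> a random vector
  whenever \<open>z\<close> and \<open>\<xi>\<close> are random elements.
\<close>

definition unbiased_stochastic_operator ::
  "'a::euclidean_space set \<Rightarrow> 'x measure \<Rightarrow> ('a \<Rightarrow> 'x \<Rightarrow> 'a) \<Rightarrow> ('a \<Rightarrow> 'a) \<Rightarrow> bool" where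
  "unbiased_stochastic_operator Q S G g \<longleftrightarrow>
     (\<lambda>(x, y). G x y) \<in> borel_measurable (restrict_space borel Q \<Otimes>\<^sub>M S) \<and>
     (\<forall>x\<in>Q. integrable S (G x) \<and> g x = (\<integral>y. G x y \<partial>S))"

definition variance_bounded_on ::
  "'a::euclidean_space set \<Rightarrow> 'x measure \<Rightarrow> ('a \<Rightarrow> 'x \<Rightarrow> 'a) \<Rightarrow> ('a \<Rightarrow> 'a) \<Rightarrow> real \<Rightarrow> bool" where
  "variance_bounded_on Q S G g \<sigma> \<longleftrightarrow>
     (\<forall>x\<in>Q. integrable S (\<lambda>y. (norm (G x y - g x))\<^sup>2) \<and>
            (\<integral>y. (norm (G x y - g x))\<^sup>2 \<partial>S) \<le> \<sigma>\<^sup>2)"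

definition iid_samples :: "'w measure \<Rightarrow> 'x measure \<Rightarrow> (nat \<Rightarrow> 'w \<Rightarrow> 'x) \<Rightarrow> bool" where
  "iid_samples P S \<xi> \<longleftrightarrow>
     prob_space.indep_vars P (\<lambda>_. S) \<xi> UNIV \<and> (\<forall>j. distr P S (\<xi> j) = S)"

text \<open>The \<open>\<sigma>\<close>-algebra generated by the first \<open>j\<close> samples \<open>\<xi> 0, \<dots>, \<xi> (j - 1)\<close>.\<close>

definition sample_history ::
  "'w measure \<Rightarrow> 'x measure \<Rightarrow> (nat \<Rightarrow> 'w \<Rightarrow> 'x) \<Rightarrow> nat \<Rightarrow> 'w measure" where
  "sample_history P S \<xi> j =
     vimage_algebra (space P) (\<lambda>\<omega>. \<lambda>i\<in>{..<j}. \<xi> i \<omega>) (PiM {..<j} (\<lambda>_. S))"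

text \<open>
  The samples are listed in the order in which they are drawn: \<open>\<xi> (2 * k)\<close> is the sample
  used at \<open>z k\<close> and \<open>\<xi> (2 * k + 1)\<close> the one used at \<open>w k\<close>. In particular \<open>\<xi> 0\<close> enters
  both the initial value \<open>L 0\<close> and the first step.

  The minimizers are unique only if \<open>L k \<omega> > 0\<close>. If \<open>L k \<omega> = 0\<close>, any minimizer may be
  chosen; the two measurability conditions say that this choice depends measurably on the
  samples drawn so far, so that \<open>z k\<close> and \<open>w k\<close> are random vectors independent of the
  sample at which the operator is next evaluated.
\<close>

definition stochastic_ump ::
  "'a::euclidean_space set \<Rightarrow> real \<Rightarrow> ('a \<Rightarrow> real) \<Rightarrow> ('a \<Rightarrow> 'x \<Rightarrow> 'a) \<Rightarrow>
   'w measure \<Rightarrow> 'x measure \<Rightarrow> (nat \<Rightarrow> 'w \<Rightarrow> 'x) \<Rightarrow>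
   (nat \<Rightarrow> 'w \<Rightarrow> 'a) \<Rightarrow> (nat \<Rightarrow> 'w \<Rightarrow> 'a) \<Rightarrow> (nat \<Rightarrow> 'w \<Rightarrow> real) \<Rightarrow> bool" where
  "stochastic_ump Q D d G P S \<xi> z w L \<longleftrightarrow>
     (\<exists>z\<^sub>0. is_arg_min d (\<lambda>u. u \<in> Q) z\<^sub>0 \<and> (\<forall>\<omega>\<in>space P. z 0 \<omega> = z\<^sub>0)) \<and>
     (\<forall>\<omega>\<in>space P. L 0 \<omega> = norm (G (z 0 \<omega>) (\<xi> 0 \<omega>))) \<and>
     (\<forall>k. \<forall>\<omega>\<in>space P.
        is_arg_min
          (\<lambda>x. G (z k \<omega>) (\<xi> (2 * k) \<omega>) \<bullet> (x - z k \<omega>) + L k \<omega> / 2 * (norm (z k \<omega> - x))\<^sup>2)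
          (\<lambda>x. x \<in> Q) (w k \<omega>) \<and>
        is_arg_min
          (\<lambda>x. G (w k \<omega>) (\<xi> (2 * k + 1) \<omega>) \<bullet> (x - w k \<omega>) + L k \<omega> / 2 * (norm (z k \<omega> - x))\<^sup>2)
          (\<lambda>x. x \<in> Q) (z (Suc k) \<omega>) \<and>
        L (Suc k) \<omega> = L k \<omega> +
          max 0 ((2 * (G (w k \<omega>) (\<xi> (2 * k + 1) \<omega>) \<bullet> (w k \<omega> - z (Suc k) \<omega>))
                    - L k \<omega> * (norm (z k \<omega> - z (Suc k) \<omega>))\<^sup>2)
                 / (D\<^sup>2 + (norm (z k \<omega> - z (Suc k) \<omega>))\<^sup>2))) \<and>
     (\<forall>k. z k \<in> borel_measurable (sample_history P S \<xi> (2 * k)) \<and>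
          w k \<in> borel_measurable (sample_history P S \<xi> (2 * k + 1)))"

end

theory Submission
  imports Defs
begin

text \<open>
  Write \<open>M j\<close>, \<open>N j\<close> for the operator values sampled at \<open>z j\<close>, \<open>w j\<close>, let \<open>\<Delta>z j\<close>, \<open>\<Delta>w j\<close> be their
  deviations from \<open>g (z j)\<close>, \<open>g (w j)\<close>, and put \<open>m = k + 1\<close>. The proof splits into an analysis of a
  single run, in which the samples are arbitrary vectors, and a few expectations.

  The rule for \<open>L\<close> makes each step pay for its own error: up to a telescoping term, step \<open>j\<close> costs
  \<open>D\<^sup>2 * (L (j + 1) - L j)\<close>. Hence the regret \<open>\<Sum>j<m. N j \<bullet> (w j - u)\<close> is at most \<open>3/2 * D\<^sup>2 * L m\<close>
  for every \<open>u \<in> Q\<close>, whatever the samples are (\<open>surrogate_regret_le\<close>). By monotonicity of \<open>g\<close>,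
  the gap at the average of the \<open>w j\<close> is then at most \<open>3/2 * D\<^sup>2 * L m / m\<close> plus the noise terms
  \<open>- (\<Sum>j<m. (w j - z 0) \<bullet> \<Delta>w j) / m\<close> and \<open>D * norm (\<Sum>j<m. \<Delta>w j) / m\<close> (\<open>gap_average_le\<close>). Splitting
  \<open>w j - u\<close> at the fixed point \<open>z 0\<close> is what allows a maximum over \<open>u\<close> inside the expectation: the
  first term is centred, and in the second \<open>u\<close> has disappeared.

  It remains to bound \<open>L m\<close> (\<open>step_size_le\<close>). If \<open>L\<close> increases at step \<open>j\<close>, then with \<open>r\<close>, \<open>s\<close> the distances
  from \<open>w j\<close> to \<open>z j\<close>, \<open>z (j + 1)\<close>, \<open>A\<close> the Hoelder constant and \<open>e = norm (\<Delta>w j - \<Delta>z j)\<close>, the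
  update rule and the minimality of \<open>w j\<close> give
  \<open>D\<^sup>2 * (L (j + 1) - L j) \<le> 2 * A * r powr \<nu> * s + 2 * e * s - L j * (r\<^sup>2 + s\<^sup>2)\<close>.
  Young's inequality at the scale \<open>\<tau> = D\<^sup>2 / m\<close> turns the Hoelder term into
  \<open>\<Lambda> * (r\<^sup>2 + s\<^sup>2) + \<Lambda> * (1 - \<nu>) * \<tau>\<close> with \<open>\<Lambda> = A * \<tau> powr ((\<nu> - 1) / 2)\<close>. The first summand merely
  shifts \<open>L j\<close> by \<open>\<Lambda>\<close>; the second adds up to \<open>\<Lambda> * (1 - \<nu>) * D\<^sup>2\<close> over all \<open>m\<close> steps. What is left is
  an AdaGrad-like recursion driven by the noise: the square of the positive part of the excess of \<open>L j\<close>
  over \<open>2 * \<Lambda>\<close> and the accumulated second summand grows by at most \<open>4 * e\<^sup>2 / D\<^sup>2\<close> per step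
  (\<open>excess_square_growth\<close>). So \<open>L m\<close> is at most
  \<open>(3 - \<nu>) * \<Lambda> + L 0 + 2 / D * sqrt (\<Sum>j<m. (norm (\<Delta>w j - \<Delta>z j))\<^sup>2)\<close>.

  In expectation, each noise vector is orthogonal to everything drawn before it, because the new sample
  is independent of the history (\<open>distr_history_sample\<close>). Thus \<open>norm (\<Sum>j<m. \<Delta>w j)\<close> has mean at most
  \<open>\<sigma> * sqrt m\<close>, and \<open>L m\<close> exceeds \<open>L 0\<close> by at most \<open>(3 - \<nu>) * \<Lambda> + 4 * \<sigma> * sqrt m / D\<close> on average.
  The resulting constants \<open>3/2 * (3 - \<nu>)\<close>, \<open>7\<close> and \<open>3/2\<close> fit into the stated ones.
\<close>

section \<open>Proximal steps and growth of the step-size parameter\<close>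

text \<open>
  Moving from the minimizer \<open>y\<close> towards \<open>u\<close> cannot decrease the objective, so the derivative at \<open>y\<close> in
  that direction is nonnegative; expanding squared distances turns this into the three-point
  inequality. The case \<open>l = 0\<close> is included because \<open>L j\<close> may vanish.
\<close>

lemma prox_three_point:
  fixes a c p u y :: "'a::real_inner"
  assumes "convex Q" "0 \<le> l" "u \<in> Q"
    and min: "is_arg_min (\<lambda>x. a \<bullet> (x - c) + l / 2 * (norm (p - x))\<^sup>2) (\<lambda>x. x \<in> Q) y"
  shows "2 * (a \<bullet> (y - u)) \<le> l * ((norm (p - u))\<^sup>2 - (norm (y - u))\<^sup>2 - (norm (p - y))\<^sup>2)"
proof -
  have "y \<in> Q"
    using min by (simp add: is_arg_min_def)
  define slope where "slope = a \<bullet> (u - y) + l * ((y - p) \<bullet> (u - y))"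
  define curv where "curv = l / 2 * (norm (u - y))\<^sup>2"
  have "0 \<le> slope + t * curv" if t: "0 < t" "t \<le> 1" for t
  proof -
    have "y + t *\<^sub>R (u - y) \<in> Q"
      using convexD_alt[OF \<open>convex Q\<close> \<open>y \<in> Q\<close> \<open>u \<in> Q\<close>, of t] t by (simp add: algebra_simps)
    hence "a \<bullet> (y - c) + l / 2 * (norm (p - y))\<^sup>2
        \<le> a \<bullet> (y + t *\<^sub>R (u - y) - c) + l / 2 * (norm (p - (y + t *\<^sub>R (u - y))))\<^sup>2"
      using min by (auto simp: is_arg_min_linorder)
    also have "\<dots> = a \<bullet> (y - c) + l / 2 * (norm (p - y))\<^sup>2 + t * (slope + t * curv)"
      unfolding slope_def curv_def power2_norm_eq_inner
      by (simp add: algebra_simps inner_commute power2_eq_square)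
    finally show ?thesis
      using t by (simp add: zero_le_mult_iff)
  qed
  hence "\<forall>\<^sub>F t in at_right 0. 0 \<le> slope + t * curv"
    unfolding eventually_at_right_field by (intro exI[of _ 1]) auto
  moreover have "((\<lambda>t. slope + t * curv) \<longlongrightarrow> slope + 0 * curv) (at_right 0)"
    by (intro tendsto_intros)
  ultimately have "0 \<le> slope"
    using tendsto_lowerbound[of "\<lambda>t. slope + t * curv" slope "at_right 0" 0] by simp
  moreover have "2 * slope = 2 * (a \<bullet> (u - y))
      + l * ((norm (p - u))\<^sup>2 - (norm (y - u))\<^sup>2 - (norm (p - y))\<^sup>2)"
    unfolding slope_def power2_norm_eq_inner by (simp add: algebra_simps inner_commute)
  ultimately show ?thesis
    by (simp add: algebra_simps)
qed

text \<open>
  Arithmetic-geometric mean applied twice: first to \<open>s\<close> and the rescaled \<open>r powr \<nu>\<close>, then to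
  \<open>r powr (2 * \<nu>)\<close> against \<open>\<tau>\<close> with weights \<open>\<nu>\<close> and \<open>1 - \<nu>\<close>. The factor \<open>1 - \<nu>\<close> in front of \<open>\<tau>\<close> has to
  be kept: as \<open>\<nu>\<close> tends to 1 the final Hoelder constant decreases to 4, and the bound
  \<open>3/2 * (3 - \<nu>)\<close> obtained from this inequality decreases to 3, whereas a factor 1
  would leave it at \<open>9/2\<close>.
\<close>

lemma hoelder_young:
  fixes r s \<tau> \<nu> :: real
  assumes "0 \<le> r" "0 \<le> s" "0 < \<tau>" "0 < \<nu>" "\<nu> < 1"
  shows "2 * (r powr \<nu> * s) \<le> \<tau> powr ((\<nu> - 1) / 2) * (r\<^sup>2 + s\<^sup>2 + (1 - \<nu>) * \<tau>)"
proof -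
  define q where "q = r powr \<nu> * \<tau> powr ((1 - \<nu>) / 2)"
  have "(r powr \<nu>)\<^sup>2 = (r\<^sup>2) powr \<nu>"
    using assms by (simp add: power2_eq_square powr_mult)
  moreover have "(\<tau> powr ((1 - \<nu>) / 2))\<^sup>2 = \<tau> powr (1 - \<nu>)"
    by (simp add: power2_eq_square flip: powr_add)
  ultimately have "q\<^sup>2 = (r\<^sup>2) powr \<nu> * \<tau> powr (1 - \<nu>)"
    by (simp add: q_def power_mult_distrib)
  also have "\<dots> \<le> \<nu> * r\<^sup>2 + (1 - \<nu>) * \<tau>"
    using Youngs_inequality_0[of \<nu> "1 - \<nu>" "r\<^sup>2" \<tau>] assms by (cases "r = 0") auto
  also have "\<dots> \<le> r\<^sup>2 + (1 - \<nu>) * \<tau>"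
    using assms by (simp add: mult_left_le_one_le)
  finally have "2 * q * s \<le> r\<^sup>2 + s\<^sup>2 + (1 - \<nu>) * \<tau>"
    using sum_squares_bound[of q s] by simp
  hence "\<tau> powr ((\<nu> - 1) / 2) * (2 * q * s)
      \<le> \<tau> powr ((\<nu> - 1) / 2) * (r\<^sup>2 + s\<^sup>2 + (1 - \<nu>) * \<tau>)"
    by (rule mult_left_mono) simp
  moreover have "\<tau> powr ((\<nu> - 1) / 2) * \<tau> powr ((1 - \<nu>) / 2) = 1"
    using assms by (simp flip: powr_add add: field_simps)
  hence "\<tau> powr ((\<nu> - 1) / 2) * (2 * q * s) = 2 * (r powr \<nu> * s)"
    unfolding q_def by (simp add: algebra_simps)
  ultimately show ?thesis by simp
qed

text \<open>
  The recursion behind the noise term. The value \<open>v = l - 2 * \<Lambda> - y\<close> is the excess over \<open>2 * \<Lambda>\<close> and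
  the accumulated drift \<open>y\<close>, while the damping coefficient is the larger quantity \<open>l - \<Lambda>\<close>. If
  \<open>l > \<Lambda>\<close> and \<open>v \<ge> e\<close>, the damping limits the increment \<open>q\<close> by both \<open>e\<^sup>2 / v\<close> and \<open>e\<close>, so \<open>v\<^sup>2\<close> grows by at most \<open>3 * e\<^sup>2\<close>. In
  all other cases the new excess is at most \<open>2 * e\<close>, whatever \<open>v\<close> was. The second multiple of \<open>\<Lambda>\<close> is the price
  of the case \<open>l \<le> \<Lambda>\<close>, where the damping has the wrong sign and a single step may carry \<open>l\<close> beyond \<open>\<Lambda>\<close>.
\<close>

lemma excess_square_growth:
  fixes l l' \<Lambda> c y e r s :: real
  assumes "0 \<le> l" "0 \<le> \<Lambda>" "0 \<le> y" "0 \<le> e"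
    and r: "0 \<le> r" "r \<le> 1" and s: "0 \<le> s" "s \<le> 1"
    and growth: "l' - l \<le> c + 2 * e * s - (l - \<Lambda>) * (r\<^sup>2 + s\<^sup>2)"
  shows "(max 0 (l' - 2 * \<Lambda> - (y + c)))\<^sup>2 \<le> (max 0 (l - 2 * \<Lambda> - y))\<^sup>2 + 4 * e\<^sup>2"
proof -
  define v where "v = l - 2 * \<Lambda> - y"
  define v' where "v' = l' - 2 * \<Lambda> - (y + c)"
  have v': "v' \<le> v + 2 * e * s - (l - \<Lambda>) * (r\<^sup>2 + s\<^sup>2)"
    using growth by (simp add: v_def v'_def)
  have r2: "r\<^sup>2 \<le> 1" and s2: "s\<^sup>2 \<le> 1"
    using r s by (simp_all add: power_le_one)
  have es: "e * s \<le> e"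
    using s \<open>0 \<le> e\<close> by (simp add: mult_left_le)
  have v_le: "v \<le> l - \<Lambda>"
    using assms by (simp add: v_def)
  have small: "(max 0 v')\<^sup>2 \<le> (max 0 v)\<^sup>2 + 4 * e\<^sup>2" if "v' \<le> 2 * e"
  proof -
    have "(max 0 v')\<^sup>2 \<le> (2 * e)\<^sup>2"
      using that \<open>0 \<le> e\<close> by (intro power_mono) auto
    thus ?thesis by (simp add: power_mult_distrib add_increasing)
  qed
  consider (below) "l \<le> \<Lambda>" | (near) "\<Lambda> < l" "v < e" | (far) "\<Lambda> < l" "e \<le> v"
    by linarith
  hence "(max 0 v')\<^sup>2 \<le> (max 0 v)\<^sup>2 + 4 * e\<^sup>2"
  proof cases
    case below
    have "(\<Lambda> - l) * (r\<^sup>2 + s\<^sup>2) \<le> (\<Lambda> - l) * 2"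
      using below r2 s2 by (intro mult_left_mono) auto
    hence "v' \<le> 2 * e"
      using v' es assms by (simp add: v_def algebra_simps)
    thus ?thesis by (rule small)
  next
    case near
    \<comment> \<open>Interpolate between \<open>v < e\<close> and the damping: \<open>v' \<le> e * (1 - s\<^sup>2) + 2 * e * s = e * (2 - (1 - s)\<^sup>2)\<close>.\<close>
    have "v * (1 - s\<^sup>2) \<le> e * (1 - s\<^sup>2)"
      using near s2 by (intro mult_right_mono) auto
    moreover have "v * s\<^sup>2 \<le> (l - \<Lambda>) * (r\<^sup>2 + s\<^sup>2)"
      using near v_le by (intro order_trans[OF mult_right_mono[OF v_le] mult_left_mono]) auto
    moreover have "0 \<le> e * (1 - s)\<^sup>2"
      using \<open>0 \<le> e\<close> by simp
    ultimately have "v' \<le> 2 * e"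
      using v' by (simp add: algebra_simps power2_eq_square)
    thus ?thesis by (rule small)
  next
    case far
    define q where "q = v' - v"
    have "v * s\<^sup>2 \<le> (l - \<Lambda>) * (r\<^sup>2 + s\<^sup>2)"
      using far v_le by (intro order_trans[OF mult_right_mono[OF v_le] mult_left_mono]) auto
    hence q: "q \<le> 2 * e * s - v * s\<^sup>2"
      using v' by (simp add: q_def)
    have "v * q \<le> v * (2 * e * s - v * s\<^sup>2)"
      using q far \<open>0 \<le> e\<close> by (intro mult_left_mono) auto
    also have "\<dots> = e\<^sup>2 - (e - v * s)\<^sup>2"
      by (simp add: algebra_simps power2_eq_square)
    finally have vq: "v * q \<le> e\<^sup>2"
      using zero_le_power2[of "e - v * s"] by linarith
    have "e * s\<^sup>2 \<le> v * s\<^sup>2" 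
      using far by (intro mult_right_mono) auto
    moreover have "0 \<le> e * (1 - s)\<^sup>2"
      using \<open>0 \<le> e\<close> by simp
    ultimately have "q \<le> e"
      using q by (simp add: algebra_simps power2_eq_square)
    show ?thesis
    proof (cases "0 \<le> q")
      case True
      have "q\<^sup>2 \<le> e\<^sup>2"
        using True \<open>q \<le> e\<close> by (intro power_mono)
      moreover have "v'\<^sup>2 = v\<^sup>2 + 2 * (v * q) + q\<^sup>2"
        by (simp add: q_def algebra_simps power2_eq_square)
      ultimately have "v'\<^sup>2 \<le> v\<^sup>2 + 4 * e\<^sup>2"
        using vq zero_le_power2[of e] by linarith
      thus ?thesis
        using far True \<open>0 \<le> e\<close> by (simp add: max_def q_def)
    next
      case False
      hence "(max 0 v')\<^sup>2 \<le> (max 0 v)\<^sup>2"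
        by (intro power_mono) (auto simp: q_def)
      thus ?thesis by (simp add: add_increasing2)
    qed
  qed
  thus ?thesis by (simp add: v_def v'_def)
qed

text \<open>
  One run of the method, with the sampled operator values replaced by arbitrary vectors \<open>M j\<close> (at
  \<open>z j\<close>) and \<open>N j\<close> (at \<open>w j\<close>).
\<close>

locale ump_path =
  fixes Q :: "'a::real_inner set" and D :: real
    and z w M N :: "nat \<Rightarrow> 'a" and L :: "nat \<Rightarrow> real"
  assumes convex: "convex Q"
    and D_pos: "0 < D"
    and diameter: "\<And>x y. x \<in> Q \<Longrightarrow> y \<in> Q \<Longrightarrow> norm (x - y) \<le> D"
    and z_0: "z 0 \<in> Q"
    and L_0: "0 \<le> L 0"
    and w_argmin: "\<And>j. is_arg_min
          (\<lambda>x. M j \<bullet> (x - z j) + L j / 2 * (norm (z j - x))\<^sup>2) (\<lambda>x. x \<in> Q) (w j)"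
    and z_argmin: "\<And>j. is_arg_min
          (\<lambda>x. N j \<bullet> (x - w j) + L j / 2 * (norm (z j - x))\<^sup>2) (\<lambda>x. x \<in> Q) (z (Suc j))"
    and L_Suc: "\<And>j. L (Suc j) = L j +
          max 0 ((2 * (N j \<bullet> (w j - z (Suc j))) - L j * (norm (z j - z (Suc j)))\<^sup>2)
                 / (D\<^sup>2 + (norm (z j - z (Suc j)))\<^sup>2))"
begin

lemma w_in: "w j \<in> Q"
  using w_argmin[of j] by (simp add: is_arg_min_def)

lemma z_in: "z j \<in> Q"
  using z_0 z_argmin[of "j - 1"] by (cases j) (auto simp: is_arg_min_def)

lemma L_mono: "L j \<le> L (Suc j)"
  by (simp add: L_Suc)

lemma L_nonneg: "0 \<le> L j"
  by (induction j) (use L_0 L_mono order_trans in blast)+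

lemma denominator_pos: "0 < D\<^sup>2 + (norm (z j - z (Suc j)))\<^sup>2"
  using D_pos by (simp add: add_pos_nonneg)

lemma norm_diff_sq_le: "x \<in> Q \<Longrightarrow> y \<in> Q \<Longrightarrow> (norm (x - y))\<^sup>2 \<le> D\<^sup>2"
  by (simp add: diameter power_mono)

text \<open>
  With \<open>b\<close> the squared distance from \<open>z j\<close> to \<open>z (j + 1)\<close>, the update picks the least
  \<open>L (j + 1) \<ge> L j\<close> such that \<open>(L (j + 1) - L j) * (D\<^sup>2 + b)\<close> covers the error
  \<open>2 * (N j \<bullet> (w j - z (j + 1))) - L j * b\<close> of the step; and \<open>b \<le> D\<^sup>2\<close>.
\<close>

lemma surrogate_regret_step:
  assumes "u \<in> Q"
  shows "2 * (N j \<bullet> (w j - u)) \<le> L j * ((norm (z j - u))\<^sup>2 - (norm (z (Suc j) - u))\<^sup>2)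
           + 2 * D\<^sup>2 * (L (Suc j) - L j)"
proof -
  define b where "b = (norm (z j - z (Suc j)))\<^sup>2"
  have "(2 * (N j \<bullet> (w j - z (Suc j))) - L j * b) / (D\<^sup>2 + b) \<le> L (Suc j) - L j"
    by (simp add: L_Suc b_def)
  hence "2 * (N j \<bullet> (w j - z (Suc j))) - L j * b \<le> (L (Suc j) - L j) * (D\<^sup>2 + b)"
    using denominator_pos[of j] by (simp add: b_def pos_divide_le_eq)
  also have "\<dots> \<le> (L (Suc j) - L j) * (2 * D\<^sup>2)"
    using norm_diff_sq_le[OF z_in z_in, of j "Suc j"] L_mono[of j]
    by (intro mult_left_mono) (auto simp: b_def)
  finally have "2 * (N j \<bullet> (w j - z (Suc j))) \<le> L j * b + 2 * D\<^sup>2 * (L (Suc j) - L j)"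
    by (simp add: algebra_simps)
  moreover have "2 * (N j \<bullet> (z (Suc j) - u))
      \<le> L j * ((norm (z j - u))\<^sup>2 - (norm (z (Suc j) - u))\<^sup>2 - b)"
    unfolding b_def by (rule prox_three_point[OF convex L_nonneg \<open>u \<in> Q\<close> z_argmin])
  moreover have "N j \<bullet> (w j - u) = N j \<bullet> (w j - z (Suc j)) + N j \<bullet> (z (Suc j) - u)"
    by (simp add: inner_diff_right)
  ultimately show ?thesis
    by (simp add: algebra_simps)
qed

text \<open>
  The weights \<open>L j\<close> vary, so the distances to \<open>u\<close> do not telescope exactly; each change of weight costs
  at most \<open>D\<^sup>2 * (L (j + 1) - L j)\<close>. Keeping the last distance on the right makes the induction close.
\<close>

lemma surrogate_regret:
  assumes "u \<in> Q"
  shows "2 * (\<Sum>j<m. N j \<bullet> (w j - u)) \<le> 3 * D\<^sup>2 * L m - L m * (norm (z m - u))\<^sup>2"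
proof (induction m)
  case 0
  have "L 0 * (norm (z 0 - u))\<^sup>2 \<le> L 0 * D\<^sup>2"
    using norm_diff_sq_le[OF z_in \<open>u \<in> Q\<close>] L_0 by (intro mult_left_mono)
  also have "\<dots> \<le> 3 * D\<^sup>2 * L 0"
    using L_0 by (simp add: mult.commute mult_right_mono)
  finally show ?case by simp
next
  case (Suc m)
  have "(L (Suc m) - L m) * (norm (z (Suc m) - u))\<^sup>2 \<le> (L (Suc m) - L m) * D\<^sup>2"
    using norm_diff_sq_le[OF z_in \<open>u \<in> Q\<close>] L_mono[of m] by (intro mult_left_mono) auto
  thus ?case
    using Suc.IH surrogate_regret_step[OF \<open>u \<in> Q\<close>, of m] by (simp add: algebra_simps)
qed

corollary surrogate_regret_le:
  assumes "u \<in> Q"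
  shows "(\<Sum>j<m. N j \<bullet> (w j - u)) \<le> 3 / 2 * D\<^sup>2 * L m"
  using surrogate_regret[OF assms, of m] mult_nonneg_nonneg[OF L_nonneg, of "(norm (z m - u))\<^sup>2" m]
  by simp

text \<open>
  When \<open>L\<close> strictly increases, its update rule is an equation. Minimality of \<open>w j\<close>, tested at
  \<open>z (j + 1)\<close>, replaces \<open>N j\<close> by the difference \<open>N j - M j\<close>, which is small by continuity of the
  operator, and produces the negative squares that damp the growth.
\<close>

lemma extragradient_bound:
  assumes "L j < L (Suc j)"
  shows "D\<^sup>2 * (L (Suc j) - L j) \<le> 2 * ((N j - M j) \<bullet> (w j - z (Suc j)))
           - L j * ((norm (w j - z j))\<^sup>2 + (norm (w j - z (Suc j)))\<^sup>2)"
proof -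
  define b where "b = (norm (z j - z (Suc j)))\<^sup>2"
  have "L (Suc j) - L j = (2 * (N j \<bullet> (w j - z (Suc j))) - L j * b) / (D\<^sup>2 + b)"
    using assms L_Suc[of j] by (auto simp: b_def max_def split: if_splits)
  moreover have "D\<^sup>2 + b \<noteq> 0"
    using denominator_pos[of j] by (simp only: b_def)
  ultimately have "(L (Suc j) - L j) * (D\<^sup>2 + b) = 2 * (N j \<bullet> (w j - z (Suc j))) - L j * b"
    by simp
  moreover have "(L (Suc j) - L j) * D\<^sup>2 \<le> (L (Suc j) - L j) * (D\<^sup>2 + b)"
    using assms by (intro mult_left_mono) (auto simp: b_def)
  moreover have "2 * (M j \<bullet> (w j - z (Suc j)))
      \<le> L j * (b - (norm (w j - z (Suc j)))\<^sup>2 - (norm (z j - w j))\<^sup>2)"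
    unfolding b_def by (rule prox_three_point[OF convex L_nonneg z_in w_argmin])
  ultimately show ?thesis
    by (simp add: algebra_simps inner_diff_left norm_minus_commute)
qed

text \<open>
  The form of \<open>extragradient_bound\<close> required by \<open>excess_square_growth\<close>: all lengths are measured in units of
  \<open>D\<close>, and the scale in \<open>hoelder_young\<close> is \<open>D\<^sup>2 / m\<close>. This scale balances the shift \<open>\<Lambda>\<close> against the
  drift \<open>\<Lambda> * (1 - \<nu>) / m\<close> summed over \<open>m\<close> steps.
\<close>

lemma step_size_growth:
  fixes m :: real
  assumes g: "hoelder_on Q \<nu> A g" and \<nu>: "0 < \<nu>" "\<nu> < 1" and "0 < m"
    and grow: "L j < L (Suc j)"
  defines "\<Lambda> \<equiv> A * (D\<^sup>2 / m) powr ((\<nu> - 1) / 2)"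
    and "e \<equiv> norm ((N j - g (w j)) - (M j - g (z j))) / D"
    and "r \<equiv> norm (w j - z j) / D" and "s \<equiv> norm (w j - z (Suc j)) / D"
  shows "L (Suc j) - L j \<le> \<Lambda> * (1 - \<nu>) / m + 2 * e * s - (L j - \<Lambda>) * (r\<^sup>2 + s\<^sup>2)"
proof -
  have "0 \<le> A"
    using g by (simp add: hoelder_on_def)
  have "norm (N j - M j) \<le> norm (g (w j) - g (z j)) + e * D"
    using norm_triangle_ineq[of "g (w j) - g (z j)" "(N j - g (w j)) - (M j - g (z j))"] D_pos
    by (simp add: e_def algebra_simps)
  also have "norm (g (w j) - g (z j)) \<le> A * norm (w j - z j) powr \<nu>"
    using g w_in z_in by (simp add: hoelder_on_def)
  finally have NM: "norm (N j - M j) \<le> A * norm (w j - z j) powr \<nu> + e * D"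
    by simp
  have rD: "norm (w j - z j) = r * D" and sD: "norm (w j - z (Suc j)) = s * D"
    using D_pos by (simp_all add: r_def s_def)
  have "(N j - M j) \<bullet> (w j - z (Suc j)) \<le> norm (N j - M j) * norm (w j - z (Suc j))"
    by (rule norm_cauchy_schwarz)
  also have "\<dots> \<le> (A * norm (w j - z j) powr \<nu> + e * D) * norm (w j - z (Suc j))"
    using NM by (intro mult_right_mono) auto
  finally have "2 * ((N j - M j) \<bullet> (w j - z (Suc j)))
      \<le> A * (2 * (norm (w j - z j) powr \<nu> * (s * D))) + 2 * e * s * D\<^sup>2"
    by (simp add: sD algebra_simps power2_eq_square)
  also have "2 * (norm (w j - z j) powr \<nu> * (s * D))
      \<le> (D\<^sup>2 / m) powr ((\<nu> - 1) / 2) * ((norm (w j - z j))\<^sup>2 + (s * D)\<^sup>2 + (1 - \<nu>) * (D\<^sup>2 / m))"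
    using D_pos \<open>0 < m\<close> \<nu> by (intro hoelder_young) (auto simp: s_def)
  also note rD
  finally have "2 * ((N j - M j) \<bullet> (w j - z (Suc j)))
      \<le> \<Lambda> * ((r * D)\<^sup>2 + (s * D)\<^sup>2 + (1 - \<nu>) * (D\<^sup>2 / m)) + 2 * e * s * D\<^sup>2"
    using \<open>0 \<le> A\<close> by (simp add: \<Lambda>_def mult_left_mono mult.assoc)
  hence "D\<^sup>2 * (L (Suc j) - L j)
      \<le> D\<^sup>2 * (\<Lambda> * (1 - \<nu>) / m + 2 * e * s - (L j - \<Lambda>) * (r\<^sup>2 + s\<^sup>2))"
    using extragradient_bound[OF grow] by (simp add: rD sD algebra_simps power_mult_distrib)
  thus ?thesis
    using D_pos by simp
qed

text \<open>
  Of the \<open>3 - \<nu>\<close> multiples of \<open>\<Lambda>\<close>, two are the threshold in \<open>excess_square_growth\<close> and \<open>1 - \<nu>\<close> is the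
  drift accumulated in \<open>m\<close> steps. The horizon \<open>m\<close> is fixed in advance: \<open>\<Lambda>\<close> depends on it.
\<close>

lemma step_size_le:
  fixes m :: nat
  assumes g: "hoelder_on Q \<nu> A g" and \<nu>: "0 < \<nu>" "\<nu> < 1" and "0 < m"
  shows "L m \<le> (3 - \<nu>) * (A * (D\<^sup>2 / m) powr ((\<nu> - 1) / 2)) + L 0
    + 2 / D * sqrt (\<Sum>j<m. (norm ((N j - g (w j)) - (M j - g (z j))))\<^sup>2)"
proof -
  define \<Lambda> where "\<Lambda> = A * (D\<^sup>2 / m) powr ((\<nu> - 1) / 2)"
  define e where "e j = norm ((N j - g (w j)) - (M j - g (z j))) / D" for j
  define y where "y j = j * (\<Lambda> * (1 - \<nu>) / m)" for j :: nat
  have "0 \<le> \<Lambda>"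
    using g by (simp add: hoelder_on_def \<Lambda>_def)
  have e_nonneg: "0 \<le> e j" for j
    using D_pos by (simp add: e_def)
  have y_nonneg: "0 \<le> y j" for j
    using \<open>0 \<le> \<Lambda>\<close> \<nu> by (simp add: y_def)
  have y_Suc: "y (Suc j) = y j + \<Lambda> * (1 - \<nu>) / m" for j
    by (simp add: y_def distrib_right add_divide_distrib)
  have y_mono: "y j \<le> y (Suc j)" for j
    using y_Suc \<open>0 \<le> \<Lambda>\<close> \<nu> by simp
  have step: "(max 0 (L (Suc j) - 2 * \<Lambda> - y (Suc j)))\<^sup>2
      \<le> (max 0 (L j - 2 * \<Lambda> - y j))\<^sup>2 + 4 * (e j)\<^sup>2" for j
  proof (cases "L j < L (Suc j)")
    case True
    show ?thesis
      unfolding y_Suc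
    proof (rule excess_square_growth)
      show "L (Suc j) - L j \<le> \<Lambda> * (1 - \<nu>) / m + 2 * e j * (norm (w j - z (Suc j)) / D)
          - (L j - \<Lambda>) * ((norm (w j - z j) / D)\<^sup>2 + (norm (w j - z (Suc j)) / D)\<^sup>2)"
        unfolding \<Lambda>_def e_def using \<open>0 < m\<close> by (intro step_size_growth[OF g \<nu> _ True]) simp
    qed (use D_pos in \<open>auto simp: L_nonneg \<open>0 \<le> \<Lambda>\<close> y_nonneg e_nonneg w_in z_in diameter\<close>)
  next
    case False
    hence "L (Suc j) = L j"
      using L_mono[of j] by simp
    hence "(max 0 (L (Suc j) - 2 * \<Lambda> - y (Suc j)))\<^sup>2 \<le> (max 0 (L j - 2 * \<Lambda> - y j))\<^sup>2"
      using y_mono[of j] by (intro power_mono) auto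
    thus ?thesis
      by (simp add: add_increasing2)
  qed
  have "(max 0 (L i - 2 * \<Lambda> - y i))\<^sup>2 \<le> (L 0)\<^sup>2 + 4 * (\<Sum>j<i. (e j)\<^sup>2)" for i
  proof (induction i)
    case 0
    have "(max 0 (L 0 - 2 * \<Lambda> - y 0))\<^sup>2 \<le> (L 0)\<^sup>2"
      using L_0 \<open>0 \<le> \<Lambda>\<close> y_nonneg[of 0] by (intro power_mono) auto
    thus ?case by simp
  next
    case (Suc i)
    thus ?case using step[of i] by simp
  qed
  hence "max 0 (L m - 2 * \<Lambda> - y m) \<le> sqrt ((L 0)\<^sup>2 + 4 * (\<Sum>j<m. (e j)\<^sup>2))"
    by (intro real_le_rsqrt)
  also have "\<dots> \<le> sqrt ((L 0)\<^sup>2) + sqrt (4 * (\<Sum>j<m. (e j)\<^sup>2))"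
    by (intro sqrt_add_le_add_sqrt) (auto simp: sum_nonneg)
  also have "(\<Sum>j<m. (e j)\<^sup>2)
      = (\<Sum>j<m. (norm ((N j - g (w j)) - (M j - g (z j))))\<^sup>2) / D\<^sup>2"
    by (simp add: e_def power_divide sum_divide_distrib)
  finally have "L m - 2 * \<Lambda> - y m \<le> L 0
      + 2 / D * sqrt (\<Sum>j<m. (norm ((N j - g (w j)) - (M j - g (z j))))\<^sup>2)"
    using D_pos L_0 by (simp add: real_sqrt_mult real_sqrt_divide)
  moreover have "y m = \<Lambda> * (1 - \<nu>)"
    using \<open>0 < m\<close> by (simp add: y_def)
  ultimately show ?thesis
    by (simp add: \<Lambda>_def[symmetric] algebra_simps)
qed

end

section \<open>Samples that are independent of the past\<close>

text \<open>
  \<open>history j\<close> is a \<open>\<sigma>\<close>-algebra on the sample space itself. Regarding the past as the identity map into it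
  makes every quantity determined by earlier samples a plain function on that space, so that no
  factorization through the tuple of earlier samples is needed.
\<close>

locale iid_sampling = prob_space P + S: prob_space S
  for P :: "'w measure" and S :: "'x measure" and \<xi> :: "nat \<Rightarrow> 'w \<Rightarrow> 'x" +
  assumes iid: "iid_samples P S \<xi>"
begin

abbreviation history :: "nat \<Rightarrow> 'w measure" where
  "history \<equiv> sample_history P S \<xi>"

lemma space_history [simp]: "space (history j) = space P"
  by (simp add: sample_history_def)

lemma sample_measurable: "\<xi> i \<in> measurable P S"
  using iid by (auto simp: iid_samples_def indep_vars_def)

lemma first_samples_measurable_history:
  "(\<lambda>\<omega>. \<lambda>i\<in>{..<j}. \<xi> i \<omega>) \<in> measurable (history j) (PiM {..<j} (\<lambda>_. S))"
  unfolding sample_history_def using measurable_space[OF sample_measurable]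
  by (intro measurable_vimage_algebra1) (auto simp: space_PiM)

lemma sample_measurable_history:
  assumes "i < j"
  shows "\<xi> i \<in> measurable (history j) S"
proof -
  have "(\<lambda>\<omega>. (\<lambda>i\<in>{..<j}. \<xi> i \<omega>) i) \<in> measurable (history j) S"
    using measurable_compose[OF first_samples_measurable_history measurable_component_singleton] assms
    by (simp add: lessThan_iff)
  thus ?thesis using assms by simp
qed

lemma id_measurable_history:
  assumes "space N = space P" "\<And>i. i < j \<Longrightarrow> \<xi> i \<in> measurable N S"
  shows "(\<lambda>\<omega>. \<omega>) \<in> measurable N (history j)"
  unfolding sample_history_def using assms
  by (intro measurable_vimage_algebra2 measurable_restrict) auto

lemma measurable_history_mono:
  assumes "f \<in> measurable (history i) N" "i \<le> j"
  shows "f \<in> measurable (history j) N"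
  using measurable_compose[OF id_measurable_history assms(1)] assms(2)
  by (simp add: sample_measurable_history)

lemma measurable_history_imp:
  assumes "f \<in> measurable (history j) N"
  shows "f \<in> measurable P N"
  using measurable_compose[OF id_measurable_history assms] by (simp add: sample_measurable)

lemma pair_sample_measurable: "(\<lambda>\<omega>. (\<omega>, \<xi> j \<omega>)) \<in> measurable P (history j \<Otimes>\<^sub>M S)"
  by (intro measurable_Pair id_measurable_history sample_measurable) auto

lemma prob_space_distr_history: "prob_space (distr P (history j) (\<lambda>\<omega>. \<omega>))"
  by (intro prob_space_distr id_measurable_history sample_measurable) auto

lemma emeasure_history_sample:
  assumes A: "A \<in> sets (history j)" and B: "B \<in> sets S"
  shows "emeasure P (A \<inter> (\<xi> j -` B \<inter> space P)) = emeasure P A * emeasure S B"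
proof -
  let ?H = "\<lambda>\<omega>. \<lambda>i\<in>{..<j}. \<xi> i \<omega>" and ?X = "\<lambda>\<omega>. \<lambda>i\<in>{j}. \<xi> i \<omega>"
  have "?H \<in> space P \<rightarrow> space (PiM {..<j} (\<lambda>_. S))"
    using measurable_space[OF sample_measurable] by (auto simp: space_PiM)
  then obtain Y where Y: "Y \<in> sets (PiM {..<j} (\<lambda>_. S))" "A = ?H -` Y \<inter> space P"
    using A by (auto simp: sample_history_def sets_vimage_algebra2)
  define B' where "B' = (\<lambda>h. h j) -` B \<inter> space (PiM {j} (\<lambda>_. S))"
  have B': "B' \<in> sets (PiM {j} (\<lambda>_. S))"
    unfolding B'_def
    by (rule measurable_sets[OF _ B], rule measurable_component_singleton) simp
  have X: "?X -` B' \<inter> space P = \<xi> j -` B \<inter> space P"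
    using measurable_space[OF sample_measurable, of _ j] by (auto simp: B'_def space_PiM)
  have "indep_var (PiM {..<j} (\<lambda>_. S)) ?H (PiM {j} (\<lambda>_. S)) ?X"
    using iid by (intro indep_var_restrict) (auto simp: iid_samples_def)
  from indep_varD[OF this Y(1) B']
  have "prob ((?H -` Y \<inter> space P) \<inter> (?X -` B' \<inter> space P))
      = prob (?H -` Y \<inter> space P) * prob (?X -` B' \<inter> space P)"
    by (simp add: vimage_def Times_Int_Times Collect_conj_eq Int_ac)
  moreover have "emeasure P (\<xi> j -` B \<inter> space P) = emeasure S B"
    using iid emeasure_distr[OF sample_measurable[of j] B] by (simp add: iid_samples_def)
  ultimately show ?thesis
    by (simp add: X Y(2) emeasure_eq_measure ennreal_mult flip: \<open>emeasure P (\<xi> j -` B \<inter> space P) = emeasure S B\<close>)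
qed

text \<open>
  Freshness of the \<open>j\<close>-th sample: jointly with the past it has a product law, so Fubini's theorem
  allows the new sample to be integrated out with the past frozen.
\<close>

lemma distr_history_sample:
  "distr P (history j \<Otimes>\<^sub>M S) (\<lambda>\<omega>. (\<omega>, \<xi> j \<omega>)) = distr P (history j) (\<lambda>\<omega>. \<omega>) \<Otimes>\<^sub>M S"
proof (rule pair_measure_eqI[symmetric])
  show "sigma_finite_measure (distr P (history j) (\<lambda>\<omega>. \<omega>))"
    using prob_space_distr_history by (rule prob_space_imp_sigma_finite)
  show "sigma_finite_measure S" ..
  show "sets (distr P (history j) (\<lambda>\<omega>. \<omega>) \<Otimes>\<^sub>M S)
      = sets (distr P (history j \<Otimes>\<^sub>M S) (\<lambda>\<omega>. (\<omega>, \<xi> j \<omega>)))"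
    by (simp cong: sets_pair_measure_cong)
next
  fix A B assume "A \<in> sets (distr P (history j) (\<lambda>\<omega>. \<omega>))" "B \<in> sets S"
  hence A: "A \<in> sets (history j)" and B: "B \<in> sets S" by auto
  have id: "(\<lambda>\<omega>. \<omega>) \<in> measurable P (history j)"
    by (intro id_measurable_history sample_measurable) auto
  have "A \<subseteq> space P"
    using sets.sets_into_space[OF A] by simp
  hence "(\<lambda>\<omega>. (\<omega>, \<xi> j \<omega>)) -` (A \<times> B) \<inter> space P = A \<inter> (\<xi> j -` B \<inter> space P)"
    and "(\<lambda>\<omega>. \<omega>) -` A \<inter> space P = A"
    by auto
  thus "emeasure (distr P (history j) (\<lambda>\<omega>. \<omega>)) A * emeasure S B
      = emeasure (distr P (history j \<Otimes>\<^sub>M S) (\<lambda>\<omega>. (\<omega>, \<xi> j \<omega>))) (A \<times> B)"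
    using A B by (simp add: emeasure_distr[OF id A] emeasure_distr[OF pair_sample_measurable]
        emeasure_history_sample)
qed

lemma fresh_sample_nonneg:
  fixes f :: "'w \<Rightarrow> 'x \<Rightarrow> real"
  assumes f: "(\<lambda>(\<omega>, y). f \<omega> y) \<in> borel_measurable (history j \<Otimes>\<^sub>M S)"
    and nonneg: "\<And>\<omega> y. 0 \<le> f \<omega> y"
    and bound: "\<And>\<omega>. \<omega> \<in> space P \<Longrightarrow> integrable S (f \<omega>) \<and> (\<integral>y. f \<omega> y \<partial>S) \<le> c"
  shows "integrable P (\<lambda>\<omega>. f \<omega> (\<xi> j \<omega>))" "(\<integral>\<omega>. f \<omega> (\<xi> j \<omega>) \<partial>P) \<le> c"
proof -
  have [measurable]: "(\<lambda>\<omega>. f \<omega> (\<xi> j \<omega>)) \<in> borel_measurable P"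
    using measurable_compose[OF pair_sample_measurable f] by simp
  obtain \<omega>0 where "\<omega>0 \<in> space P"
    using not_empty by auto
  hence "0 \<le> c"
    using bound[of \<omega>0] Bochner_Integration.integral_nonneg[of S "f \<omega>0"] nonneg by fastforce
  have "sets (distr P (history j) (\<lambda>\<omega>. \<omega>) \<Otimes>\<^sub>M S) = sets (history j \<Otimes>\<^sub>M S)"
    by (rule sets_pair_measure_cong) simp_all
  hence fR: "(\<lambda>p. ennreal (case p of (\<omega>, y) \<Rightarrow> f \<omega> y))
      \<in> borel_measurable (distr P (history j) (\<lambda>\<omega>. \<omega>) \<Otimes>\<^sub>M S)"
    using measurable_compose[OF f measurable_ennreal] by (simp cong: measurable_cong_sets)
  have "(\<integral>\<^sup>+\<omega>. ennreal (f \<omega> (\<xi> j \<omega>)) \<partial>P)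
      = (\<integral>\<^sup>+p. ennreal (case p of (\<omega>, y) \<Rightarrow> f \<omega> y) \<partial>distr P (history j \<Otimes>\<^sub>M S) (\<lambda>\<omega>. (\<omega>, \<xi> j \<omega>)))"
    using f by (subst nn_integral_distr[OF pair_sample_measurable]) auto
  also have "\<dots> = (\<integral>\<^sup>+\<omega>. \<integral>\<^sup>+y. ennreal (f \<omega> y) \<partial>S \<partial>distr P (history j) (\<lambda>\<omega>. \<omega>))"
    unfolding distr_history_sample using S.nn_integral_fst[OF fR] by simp
  also have "\<dots> \<le> (\<integral>\<^sup>+\<omega>. ennreal c \<partial>distr P (history j) (\<lambda>\<omega>. \<omega>))"
    using bound nonneg
    by (intro nn_integral_mono) (auto simp: nn_integral_eq_integral intro!: ennreal_leI)
  also have "\<dots> = ennreal c"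
    using prob_space.emeasure_space_1[OF prob_space_distr_history] by simp
  finally have le: "(\<integral>\<^sup>+\<omega>. ennreal (f \<omega> (\<xi> j \<omega>)) \<partial>P) \<le> ennreal c" .
  show int: "integrable P (\<lambda>\<omega>. f \<omega> (\<xi> j \<omega>))"
    using le by (intro integrableI_bounded) (auto simp: nonneg intro: le_less_trans)
  show "(\<integral>\<omega>. f \<omega> (\<xi> j \<omega>) \<partial>P) \<le> c"
    using le nn_integral_eq_integral[OF int] nonneg \<open>0 \<le> c\<close> by simp
qed

lemma fresh_sample_centred:
  fixes f :: "'w \<Rightarrow> 'x \<Rightarrow> real"
  assumes f: "(\<lambda>(\<omega>, y). f \<omega> y) \<in> borel_measurable (history j \<Otimes>\<^sub>M S)"
    and int: "integrable P (\<lambda>\<omega>. f \<omega> (\<xi> j \<omega>))"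
    and centred: "\<And>\<omega>. \<omega> \<in> space P \<Longrightarrow> (\<integral>y. f \<omega> y \<partial>S) = 0"
  shows "(\<integral>\<omega>. f \<omega> (\<xi> j \<omega>) \<partial>P) = 0"
proof -
  let ?R = "distr P (history j) (\<lambda>\<omega>. \<omega>)"
  interpret R: prob_space ?R
    by (rule prob_space_distr_history)
  interpret pair_sigma_finite ?R S ..
  have "integrable (distr P (history j \<Otimes>\<^sub>M S) (\<lambda>\<omega>. (\<omega>, \<xi> j \<omega>))) (\<lambda>(\<omega>, y). f \<omega> y)"
    using int f by (subst integrable_distr_eq[OF pair_sample_measurable]) auto
  hence intp: "integrable (?R \<Otimes>\<^sub>M S) (\<lambda>(\<omega>, y). f \<omega> y)"
    by (simp add: distr_history_sample)
  have "(\<integral>\<omega>. f \<omega> (\<xi> j \<omega>) \<partial>P)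
      = (\<integral>p. (case p of (\<omega>, y) \<Rightarrow> f \<omega> y) \<partial>distr P (history j \<Otimes>\<^sub>M S) (\<lambda>\<omega>. (\<omega>, \<xi> j \<omega>)))"
    using f by (subst integral_distr[OF pair_sample_measurable]) auto
  also have "\<dots> = (\<integral>\<omega>. \<integral>y. f \<omega> y \<partial>S \<partial>?R)"
    unfolding distr_history_sample using integral_fst[OF intp] by simp
  also have "\<dots> = 0"
    using centred by (subst Bochner_Integration.integral_cong[OF refl, of _ _ "\<lambda>_. 0"]) auto
  finally show ?thesis .
qed

end

section \<open>The noise of a stochastic operator\<close>

text \<open>
  Jensen's inequality for the square root, obtained from \<open>sqrt x \<le> (x / c + c) / 2\<close>, the tangent at \<open>c\<^sup>2\<close>.
\<close>

lemma (in prob_space) expectation_sqrt_le: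
  fixes X :: "'a \<Rightarrow> real"
  assumes X: "integrable M X" and nonneg: "\<And>\<omega>. 0 \<le> X \<omega>" and le: "expectation X \<le> c\<^sup>2" and "0 < c"
  shows "integrable M (\<lambda>\<omega>. sqrt (X \<omega>))" "expectation (\<lambda>\<omega>. sqrt (X \<omega>)) \<le> c"
proof -
  have amgm: "sqrt (X \<omega>) \<le> (X \<omega> / c + c) / 2" for \<omega>
    using sum_squares_bound[of "sqrt (X \<omega>)" c] \<open>0 < c\<close> nonneg[of \<omega>]
    by (simp add: field_simps power2_eq_square)
  have int: "integrable M (\<lambda>\<omega>. (X \<omega> / c + c) / 2)"
    using X by simp
  show sqrt: "integrable M (\<lambda>\<omega>. sqrt (X \<omega>))"
    by (rule Bochner_Integration.integrable_bound[OF int])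
       (use X amgm nonneg in \<open>auto intro!: AE_I2 intro: order_trans[OF _ abs_ge_self]\<close>)
  have "expectation (\<lambda>\<omega>. sqrt (X \<omega>)) \<le> expectation (\<lambda>\<omega>. (X \<omega> / c + c) / 2)"
    by (intro integral_mono sqrt int amgm)
  also have "\<dots> = (expectation X / c + c) / 2"
    using X by (simp add: prob_space)
  also have "\<dots> \<le> c"
    using le \<open>0 < c\<close> by (simp add: field_simps power2_eq_square)
  finally show "expectation (\<lambda>\<omega>. sqrt (X \<omega>)) \<le> c" .
qed

locale stochastic_oracle = iid_sampling P S \<xi>
  for P :: "'w measure" and S :: "'x measure" and \<xi> :: "nat \<Rightarrow> 'w \<Rightarrow> 'x" +
  fixes Q :: "'a::euclidean_space set" and G :: "'a \<Rightarrow> 'x \<Rightarrow> 'a" and g :: "'a \<Rightarrow> 'a" and \<sigma> :: real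
  assumes continuous_g: "continuous_on Q g"
    and unbiased: "unbiased_stochastic_operator Q S G g"
    and variance: "variance_bounded_on Q S G g \<sigma>"
begin

lemma noise_measurable:
  assumes X: "X \<in> borel_measurable N" "\<And>\<omega>. \<omega> \<in> space N \<Longrightarrow> X \<omega> \<in> Q" and Y: "Y \<in> measurable N S"
  shows "(\<lambda>\<omega>. G (X \<omega>) (Y \<omega>) - g (X \<omega>)) \<in> borel_measurable N"
proof -
  have XQ: "X \<in> measurable N (restrict_space borel Q)"
    using X by (intro measurable_restrict_space2) auto
  have "(\<lambda>(x, y). G x y) \<in> borel_measurable (restrict_space borel Q \<Otimes>\<^sub>M S)"
    using unbiased by (simp add: unbiased_stochastic_operator_def)
  from measurable_compose[OF measurable_Pair[OF XQ Y] this]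
  have "(\<lambda>\<omega>. G (X \<omega>) (Y \<omega>)) \<in> borel_measurable N"
    by simp
  moreover have "(\<lambda>\<omega>. g (X \<omega>)) \<in> borel_measurable N"
    by (rule measurable_compose[OF XQ borel_measurable_continuous_on_restrict[OF continuous_g]])
  ultimately show ?thesis
    by simp
qed

lemma noise_pair_measurable:
  assumes "X \<in> borel_measurable (history j)" "\<And>\<omega>. \<omega> \<in> space P \<Longrightarrow> X \<omega> \<in> Q"
  shows "(\<lambda>p. G (X (fst p)) (snd p) - g (X (fst p))) \<in> borel_measurable (history j \<Otimes>\<^sub>M S)"
  using assms by (intro noise_measurable measurable_compose[OF measurable_fst]) (auto simp: space_pair_measure)

text \<open>
  The evaluation point \<open>X\<close> is random, but constant once the past is frozen; so the variance bound at
  fixed points carries over.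
\<close>

lemma noise_second_moment:
  assumes X: "X \<in> borel_measurable (history j)" "\<And>\<omega>. \<omega> \<in> space P \<Longrightarrow> X \<omega> \<in> Q"
  shows "integrable P (\<lambda>\<omega>. (norm (G (X \<omega>) (\<xi> j \<omega>) - g (X \<omega>)))\<^sup>2)"
    and "expectation (\<lambda>\<omega>. (norm (G (X \<omega>) (\<xi> j \<omega>) - g (X \<omega>)))\<^sup>2) \<le> \<sigma>\<^sup>2"
proof -
  have "(\<lambda>(\<omega>, y). (norm (G (X \<omega>) y - g (X \<omega>)))\<^sup>2) \<in> borel_measurable (history j \<Otimes>\<^sub>M S)"
    using noise_pair_measurable[OF X] by (simp add: case_prod_beta)
  from fresh_sample_nonneg[OF this, of "\<sigma>\<^sup>2"]
  show "integrable P (\<lambda>\<omega>. (norm (G (X \<omega>) (\<xi> j \<omega>) - g (X \<omega>)))\<^sup>2)"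
    and "expectation (\<lambda>\<omega>. (norm (G (X \<omega>) (\<xi> j \<omega>) - g (X \<omega>)))\<^sup>2) \<le> \<sigma>\<^sup>2"
    using variance X(2) by (auto simp: variance_bounded_on_def)
qed

text \<open>
  With the past frozen, \<open>Y\<close> is a constant vector and unbiasedness makes the mean of the noise vanish.
  Square integrability of \<open>Y\<close> and of the noise makes the product integrable.
\<close>

lemma noise_orthogonal_to_past:
  assumes X: "X \<in> borel_measurable (history j)" "\<And>\<omega>. \<omega> \<in> space P \<Longrightarrow> X \<omega> \<in> Q"
    and Y: "Y \<in> borel_measurable (history j)" "integrable P (\<lambda>\<omega>. (norm (Y \<omega>))\<^sup>2)"
  shows "integrable P (\<lambda>\<omega>. Y \<omega> \<bullet> (G (X \<omega>) (\<xi> j \<omega>) - g (X \<omega>)))"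
    and "expectation (\<lambda>\<omega>. Y \<omega> \<bullet> (G (X \<omega>) (\<xi> j \<omega>) - g (X \<omega>))) = 0"
proof -
  let ?f = "\<lambda>\<omega> y. Y \<omega> \<bullet> (G (X \<omega>) y - g (X \<omega>))"
  have f: "(\<lambda>(\<omega>, y). ?f \<omega> y) \<in> borel_measurable (history j \<Otimes>\<^sub>M S)"
    using noise_pair_measurable[OF X] measurable_compose[OF measurable_fst Y(1)]
    unfolding case_prod_beta' by (intro borel_measurable_inner)
  have fP: "(\<lambda>\<omega>. ?f \<omega> (\<xi> j \<omega>)) \<in> borel_measurable P"
    using measurable_compose[OF pair_sample_measurable f] by simp
  show int: "integrable P (\<lambda>\<omega>. ?f \<omega> (\<xi> j \<omega>))"
  proof (rule Bochner_Integration.integrable_bound)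
    show "integrable P (\<lambda>\<omega>. ((norm (Y \<omega>))\<^sup>2 + (norm (G (X \<omega>) (\<xi> j \<omega>) - g (X \<omega>)))\<^sup>2) / 2)"
      using noise_second_moment(1)[OF X] Y(2) by simp
    have "\<bar>a \<bullet> b\<bar> \<le> ((norm a)\<^sup>2 + (norm b)\<^sup>2) / 2" for a b :: 'a
      using Cauchy_Schwarz_ineq2[of a b] sum_squares_bound[of "norm a" "norm b"] by simp
    thus "AE \<omega> in P. norm (?f \<omega> (\<xi> j \<omega>))
        \<le> norm (((norm (Y \<omega>))\<^sup>2 + (norm (G (X \<omega>) (\<xi> j \<omega>) - g (X \<omega>)))\<^sup>2) / 2)"
      by (intro AE_I2) (simp add: order_trans[OF _ abs_ge_self])
  qed (rule fP)
  show "expectation (\<lambda>\<omega>. ?f \<omega> (\<xi> j \<omega>)) = 0"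
  proof (rule fresh_sample_centred[OF f int])
    fix \<omega> assume "\<omega> \<in> space P"
    hence "integrable S (G (X \<omega>))" "g (X \<omega>) = S.expectation (G (X \<omega>))"
      using unbiased X(2) by (auto simp: unbiased_stochastic_operator_def)
    thus "S.expectation (?f \<omega>) = 0"
      by (simp add: S.prob_space)
  qed
qed

text \<open>
  The noise vectors are orthogonal increments, so that second moments add up instead of norms; this is
  where \<open>sqrt n\<close> rather than \<open>n\<close> comes from. The index map \<open>t\<close> picks the samples used at the points
  \<open>w i\<close>, which are every other one.
\<close>

lemma noise_sum_second_moment:
  fixes t :: "nat \<Rightarrow> nat"
  assumes t: "strict_mono t"
    and X: "\<And>i. X i \<in> borel_measurable (history (t i))" "\<And>i \<omega>. \<omega> \<in> space P \<Longrightarrow> X i \<omega> \<in> Q"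
  defines "\<Delta> \<equiv> \<lambda>i \<omega>. G (X i \<omega>) (\<xi> (t i) \<omega>) - g (X i \<omega>)"
  shows "integrable P (\<lambda>\<omega>. (norm (\<Sum>i<n. \<Delta> i \<omega>))\<^sup>2)
    \<and> expectation (\<lambda>\<omega>. (norm (\<Sum>i<n. \<Delta> i \<omega>))\<^sup>2) \<le> real n * \<sigma>\<^sup>2"
proof (induction n)
  case 0
  show ?case by simp
next
  case (Suc n)
  let ?T = "\<lambda>\<omega>. \<Sum>i<n. \<Delta> i \<omega>"
  have "\<Delta> i \<in> borel_measurable (history (t n))" if "i < n" for i
  proof -
    have "t i < t n"
      using strict_monoD[OF t that] .
    thus ?thesis
      unfolding \<Delta>_def using X
      by (intro noise_measurable sample_measurable_history measurable_history_mono[OF X(1)]) auto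
  qed
  hence T: "?T \<in> borel_measurable (history (t n))"
    by (intro borel_measurable_sum) auto
  have cross: "integrable P (\<lambda>\<omega>. ?T \<omega> \<bullet> \<Delta> n \<omega>)" "expectation (\<lambda>\<omega>. ?T \<omega> \<bullet> \<Delta> n \<omega>) = 0"
    unfolding \<Delta>_def using noise_orthogonal_to_past[OF X T] Suc.IH by (simp_all add: \<Delta>_def)
  have last: "integrable P (\<lambda>\<omega>. (norm (\<Delta> n \<omega>))\<^sup>2)" "expectation (\<lambda>\<omega>. (norm (\<Delta> n \<omega>))\<^sup>2) \<le> \<sigma>\<^sup>2"
    unfolding \<Delta>_def using noise_second_moment[OF X] by simp_all
  have "(norm (\<Sum>i<Suc n. \<Delta> i \<omega>))\<^sup>2 = (norm (?T \<omega>))\<^sup>2 + 2 * (?T \<omega> \<bullet> \<Delta> n \<omega>) + (norm (\<Delta> n \<omega>))\<^sup>2" for \<omega>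
    by (simp add: power2_norm_eq_inner inner_add_left inner_add_right inner_commute)
  thus ?case
    using Suc.IH cross last by (simp add: algebra_simps)
qed

end


section \<open>The gap function\<close>

text \<open>
  Monotonicity replaces \<open>g u\<close> by \<open>g (w j)\<close>, making the expression linear in \<open>u\<close>. The reference point
  \<open>z\<^sub>0\<close> then separates the noise into a sum independent of \<open>u\<close> and one in which \<open>u\<close> enters only through
  \<open>u - z\<^sub>0\<close>, of norm at most \<open>D\<close>.
\<close>

lemma gap_average_le:
  fixes Q :: "'a::real_inner set"
  assumes mono: "monotone_operator_on Q g" and w: "\<And>j. w j \<in> Q" and "z\<^sub>0 \<in> Q" and "0 < m"
    and diameter: "\<And>x y. x \<in> Q \<Longrightarrow> y \<in> Q \<Longrightarrow> norm (x - y) \<le> D"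
    and regret: "\<And>u. u \<in> Q \<Longrightarrow> (\<Sum>j<m. N j \<bullet> (w j - u)) \<le> c"
  shows "Gap Q g ((1 / real m) *\<^sub>R (\<Sum>j<m. w j))
    \<le> (c - (\<Sum>j<m. (w j - z\<^sub>0) \<bullet> (N j - g (w j))) + D * norm (\<Sum>j<m. N j - g (w j))) / real m"
  unfolding Gap_def
proof (rule cSUP_least)
  fix u assume "u \<in> Q"
  have "real m * (g u \<bullet> ((1 / real m) *\<^sub>R (\<Sum>j<m. w j) - u)) = (\<Sum>j<m. g u \<bullet> (w j - u))"
    using \<open>0 < m\<close> by (simp add: inner_diff_right inner_sum_right sum_subtractf algebra_simps)
  also have "\<dots> \<le> (\<Sum>j<m. g (w j) \<bullet> (w j - u))"
    using mono w \<open>u \<in> Q\<close>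
    by (intro sum_mono) (auto simp: monotone_operator_on_def inner_diff_left)
  also have "\<dots> = (\<Sum>j<m. N j \<bullet> (w j - u) - (w j - z\<^sub>0) \<bullet> (N j - g (w j))
      + (N j - g (w j)) \<bullet> (u - z\<^sub>0))"
    by (intro sum.cong) (simp_all add: inner_diff_left inner_diff_right inner_commute)
  also have "\<dots> = (\<Sum>j<m. N j \<bullet> (w j - u)) - (\<Sum>j<m. (w j - z\<^sub>0) \<bullet> (N j - g (w j)))
      + (\<Sum>j<m. N j - g (w j)) \<bullet> (u - z\<^sub>0)"
    by (simp add: sum.distrib sum_subtractf inner_sum_left inner_diff_left)
  also have "(\<Sum>j<m. N j - g (w j)) \<bullet> (u - z\<^sub>0) \<le> norm (\<Sum>j<m. N j - g (w j)) * norm (u - z\<^sub>0)"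
    by (rule norm_cauchy_schwarz)
  also have "\<dots> \<le> norm (\<Sum>j<m. N j - g (w j)) * D"
    using diameter[OF \<open>u \<in> Q\<close> \<open>z\<^sub>0 \<in> Q\<close>] by (intro mult_left_mono) auto
  finally show "g u \<bullet> ((1 / real m) *\<^sub>R (\<Sum>j<m. w j) - u)
      \<le> (c - (\<Sum>j<m. (w j - z\<^sub>0) \<bullet> (N j - g (w j))) + D * norm (\<Sum>j<m. N j - g (w j))) / real m"
    using regret[OF \<open>u \<in> Q\<close>] \<open>0 < m\<close> by (simp add: field_simps)
qed (use \<open>z\<^sub>0 \<in> Q\<close> in auto)

text \<open>
  A supremum of affine functions whose slopes \<open>g u\<close> are uniformly bounded is Lipschitz. Continuity makes
  the gap at a random point a random variable, bounded on \<open>Q\<close>.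
\<close>

lemma continuous_on_Gap:
  fixes Q :: "'a::real_inner set"
  assumes "compact Q" "Q \<noteq> {}" "continuous_on Q g"
  shows "continuous_on UNIV (Gap Q g)"
proof -
  obtain B where B: "\<And>u. u \<in> Q \<Longrightarrow> norm (g u) \<le> B"
    using compact_imp_bounded[OF compact_continuous_image[OF assms(3,1)]]
    by (auto simp: bounded_iff)
  have "0 \<le> B"
    using B \<open>Q \<noteq> {}\<close> norm_ge_zero order_trans by blast
  have bdd: "bdd_above ((\<lambda>u. g u \<bullet> (y - u)) ` Q)" for y
    using assms
    by (intro bounded_imp_bdd_above compact_imp_bounded compact_continuous_image continuous_intros)
  have le: "Gap Q g x \<le> Gap Q g y + B * norm (x - y)" for x y
    unfolding Gap_def
  proof (rule cSUP_least[OF \<open>Q \<noteq> {}\<close>])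
    fix u assume "u \<in> Q"
    have "g u \<bullet> (x - u) = g u \<bullet> (y - u) + g u \<bullet> (x - y)"
      by (simp add: inner_diff_right)
    moreover have "g u \<bullet> (x - y) \<le> B * norm (x - y)"
      using norm_cauchy_schwarz[of "g u" "x - y"] B[OF \<open>u \<in> Q\<close>]
      by (meson mult_right_mono norm_ge_zero order_trans)
    moreover have "g u \<bullet> (y - u) \<le> (SUP u\<in>Q. g u \<bullet> (y - u))"
      by (rule cSUP_upper[OF \<open>u \<in> Q\<close> bdd])
    ultimately show "g u \<bullet> (x - u) \<le> (SUP u\<in>Q. g u \<bullet> (y - u)) + B * norm (x - y)"
      by linarith
  qed
  have "dist (Gap Q g x) (Gap Q g y) \<le> B * dist x y" for x y
    using le[of x y] le[of y x] by (simp add: dist_norm abs_le_iff norm_minus_commute)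
  hence "B-lipschitz_on UNIV (Gap Q g)"
    using \<open>0 \<le> B\<close> by (intro lipschitz_onI)
  thus ?thesis
    by (rule lipschitz_on_continuous_on)
qed

lemma hoelder_on_imp_continuous_on:
  assumes "hoelder_on Q \<nu> A g" "0 < \<nu>"
  shows "continuous_on Q g"
  unfolding continuous_on_def
proof
  fix x assume "x \<in> Q"
  have "((\<lambda>y. A * norm (y - x) powr \<nu>) \<longlongrightarrow> A * norm (x - x) powr \<nu>) (at x within Q)"
    using \<open>0 < \<nu>\<close> by (intro tendsto_intros) auto
  hence "((\<lambda>y. A * norm (y - x) powr \<nu>) \<longlongrightarrow> 0) (at x within Q)"
    by simp
  moreover have "\<forall>\<^sub>F y in at x within Q. norm (g y - g x) \<le> A * norm (y - x) powr \<nu>"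
    using assms(1) \<open>x \<in> Q\<close> by (auto simp: hoelder_on_def eventually_at_filter)
  ultimately have "((\<lambda>y. g y - g x) \<longlongrightarrow> 0) (at x within Q)"
    by (rule Lim_null_comparison[rotated])
  thus "(g \<longlongrightarrow> g x) (at x within Q)"
    by (simp add: LIM_zero_iff)
qed

section \<open>Constants of the rate\<close>

text \<open>
  After cancelling powers the claim is \<open>3/2 * (3 - \<nu>) \<le> 32 / 8 powr p\<close> with \<open>p = (1 + \<nu>) / 2\<close>, that is
  \<open>3/4 * (3 - \<nu>) \<le> 2 * 8 powr (1 - p)\<close>, which follows from \<open>8 powr x \<ge> 1 + x\<close>.
\<close>

lemma hoelder_rate_le:
  fixes \<nu> A D :: real and k :: nat
  assumes "0 < \<nu>" "\<nu> < 1" "0 \<le> A" "0 < D" "1 \<le> k"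
  defines "\<tau> \<equiv> D\<^sup>2 / (real k + 1)"
  shows "3 / 2 * \<tau> * ((3 - \<nu>) * (A * \<tau> powr ((\<nu> - 1) / 2)))
    \<le> 32 * (D\<^sup>2 / (8 * real k)) powr ((1 + \<nu>) / 2) * A"
proof -
  define p where "p = (1 + \<nu>) / 2"
  have "\<tau> > 0"
    using assms by (simp add: \<tau>_def)
  have "\<tau> * \<tau> powr ((\<nu> - 1) / 2) = \<tau> powr 1 * \<tau> powr ((\<nu> - 1) / 2)"
    using \<open>\<tau> > 0\<close> by simp
  also have "\<dots> = \<tau> powr p"
    by (simp only: p_def flip: powr_add) (simp add: field_simps)
  also have "\<dots> \<le> (D\<^sup>2 / real k) powr p"
    using assms by (intro powr_mono2) (auto simp: \<tau>_def p_def intro!: divide_left_mono)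
  finally have \<tau>p: "\<tau> * \<tau> powr ((\<nu> - 1) / 2) \<le> (D\<^sup>2 / real k) powr p" .
  have "ln (8::real) \<ge> 1"
    using exp_le by (simp add: ln_ge_iff)
  hence "1 + (1 - p) \<le> 1 + (1 - p) * ln 8"
    using \<open>\<nu> < 1\<close> by (simp add: p_def)
  also have "\<dots> \<le> 8 powr (1 - p)"
    using exp_ge_add_one_self[of "(1 - p) * ln 8"] by (simp add: powr_def)
  also have "\<dots> = 8 / 8 powr p"
    by (simp add: powr_diff)
  finally have "3 / 2 * (3 - \<nu>) \<le> 32 / 8 powr p"
    using \<open>\<nu> < 1\<close> by (simp add: p_def field_simps)
  hence "3 / 2 * (3 - \<nu>) * A * (\<tau> * \<tau> powr ((\<nu> - 1) / 2)) \<le> 32 / 8 powr p * A * (D\<^sup>2 / real k) powr p"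
    using \<tau>p assms \<open>\<tau> > 0\<close> by (intro mult_mono) auto
  moreover have "(D\<^sup>2 / (8 * real k)) powr p = (D\<^sup>2 / real k) powr p / 8 powr p"
    using powr_divide[of "D\<^sup>2 / real k" 8 p] by (simp add: mult.commute)
  ultimately show ?thesis
    by (simp add: p_def algebra_simps)
qed

lemma noise_rate_le:
  fixes \<sigma> D :: real and k :: nat
  assumes "0 < D" "0 < \<sigma>" "1 \<le> k"
  shows "7 * D * \<sigma> * sqrt (real k + 1) / (real k + 1) \<le> 32 * D / sqrt (8 * real k) * \<sigma>"
proof -
  have "sqrt (real k + 1) / (real k + 1) = 1 / sqrt (real k + 1)"
    by (simp add: field_simps)
  also have "\<dots> \<le> 1 / sqrt (real k)"
    using assms by (intro divide_left_mono) auto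
  finally have "7 * D * \<sigma> * (sqrt (real k + 1) / (real k + 1)) \<le> 7 * D * \<sigma> * (1 / sqrt (real k))"
    using assms by (intro mult_left_mono) auto
  also have "\<dots> = 7 * sqrt 8 * (D * \<sigma> / sqrt (8 * real k))"
    using assms by (simp add: real_sqrt_mult)
  also have "\<dots> \<le> 32 * (D * \<sigma> / sqrt (8 * real k))"
  proof (rule mult_right_mono)
    have "sqrt 8 \<le> 32 / 7"
      by (rule real_le_lsqrt) (simp_all add: power2_eq_square)
    thus "7 * sqrt 8 \<le> 32"
      by simp
  qed (use assms in simp)
  finally show ?thesis
    by simp
qed

section \<open>Convergence in expectation\<close>

theorem theorem2:
  fixes Q :: "(real ^ 'n) set"
    and g :: "real ^ 'n \<Rightarrow> real ^ 'n"
    and G :: "real ^ 'n \<Rightarrow> 'x \<Rightarrow> real ^ 'n"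
    and d :: "real ^ 'n \<Rightarrow> real"
    and P :: "'w measure" and S :: "'x measure"
    and \<xi> :: "nat \<Rightarrow> 'w \<Rightarrow> 'x"
    and z w :: "nat \<Rightarrow> 'w \<Rightarrow> real ^ 'n"
    and L :: "nat \<Rightarrow> 'w \<Rightarrow> real"
    and D \<nu> L\<^sub>\<nu> \<sigma> :: real and k :: nat
  assumes "convex Q" and "compact Q"
    and "0 < D" and "\<And>x y. x \<in> Q \<Longrightarrow> y \<in> Q \<Longrightarrow> norm (x - y) \<le> D"
    and "prob_space S" and "unbiased_stochastic_operator Q S G g"
    and "monotone_operator_on Q g"
    and "0 < \<nu>" and "\<nu> < 1" and "hoelder_on Q \<nu> L\<^sub>\<nu> g"
    and "0 < \<sigma>" and "variance_bounded_on Q S G g \<sigma>"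
    and "prob_space P" and "iid_samples P S \<xi>"
    and "stochastic_ump Q D d G P S \<xi> z w L"
    and "1 \<le> k"
  defines "w_hat \<equiv> \<lambda>\<omega>. (1 / (real k + 1)) *\<^sub>R (\<Sum>i\<le>k. w i \<omega>)"
  shows "integrable P (\<lambda>\<omega>. Gap Q g (w_hat \<omega>)) \<and>
    (\<integral>\<omega>. Gap Q g (w_hat \<omega>) \<partial>P)
      \<le> 32 * (D\<^sup>2 / (8 * real k)) powr ((1 + \<nu>) / 2) * L\<^sub>\<nu>
        + 32 * D / sqrt (8 * real k) * \<sigma>
        + 2 * D\<^sup>2 * (\<integral>\<omega>. L 0 \<omega> \<partial>P) / real k"
proof -
  have cont: "continuous_on Q g"
    using \<open>hoelder_on Q \<nu> L\<^sub>\<nu> g\<close> \<open>0 < \<nu>\<close> by (rule hoelder_on_imp_continuous_on)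
  interpret prob_space P by fact
  interpret S: prob_space S by fact
  interpret stochastic_oracle P S \<xi> Q G g \<sigma>
    by unfold_locales (fact cont assms)+
  note ump = \<open>stochastic_ump Q D d G P S \<xi> z w L\<close>[unfolded stochastic_ump_def]
  obtain z\<^sub>0 where z0: "z\<^sub>0 \<in> Q" "\<And>\<omega>. \<omega> \<in> space P \<Longrightarrow> z 0 \<omega> = z\<^sub>0"
    using ump by (auto simp: is_arg_min_def)
  have L0: "L 0 \<omega> = norm (G z\<^sub>0 (\<xi> 0 \<omega>))" if "\<omega> \<in> space P" for \<omega>
    using ump z0(2)[OF that] that by simp
  have zm: "z j \<in> borel_measurable (history (2 * j))"
    and wm: "w j \<in> borel_measurable (history (2 * j + 1))" for j
    using ump by auto
  have path: "ump_path Q D (\<lambda>j. z j \<omega>) (\<lambda>j. w j \<omega>) (\<lambda>j. G (z j \<omega>) (\<xi> (2 * j) \<omega>))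
      (\<lambda>j. G (w j \<omega>) (\<xi> (2 * j + 1) \<omega>)) (\<lambda>j. L j \<omega>)" if "\<omega> \<in> space P" for \<omega>
    using ump that L0[OF that] z0 assms(1-4) by unfold_locales auto
  have zQ: "z j \<omega> \<in> Q" and wQ: "w j \<omega> \<in> Q" if "\<omega> \<in> space P" for j \<omega>
    using ump_path.z_in[OF path[OF that]] ump_path.w_in[OF path[OF that]] by auto

  define m where "m = Suc k"
  have m: "0 < m" "real m = real k + 1"
    by (simp_all add: m_def)
  define \<Delta>w where "\<Delta>w j \<omega> = G (w j \<omega>) (\<xi> (2 * j + 1) \<omega>) - g (w j \<omega>)" for j \<omega>
  define \<Delta>z where "\<Delta>z j \<omega> = G (z j \<omega>) (\<xi> (2 * j) \<omega>) - g (z j \<omega>)" for j \<omega>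
  define \<Lambda> where "\<Lambda> = L\<^sub>\<nu> * (D\<^sup>2 / real m) powr ((\<nu> - 1) / 2)"
  \<comment> \<open>Bounding \<open>(norm (a - b))\<^sup>2\<close> by twice the sum of squares decouples the two noises of a step, at the
      cost of a factor that \<open>32 / sqrt 8\<close> absorbs.\<close>
  define V where "V \<omega> = (\<Sum>j<m. 2 * ((norm (\<Delta>w j \<omega>))\<^sup>2 + (norm (\<Delta>z j \<omega>))\<^sup>2))" for \<omega>
  define T where "T \<omega> = (norm (\<Sum>j<m. \<Delta>w j \<omega>))\<^sup>2" for \<omega>
  define C where "C \<omega> = (\<Sum>j<m. (w j \<omega> - z\<^sub>0) \<bullet> \<Delta>w j \<omega>)" for \<omega>
  define R where "R \<omega> = (3 / 2 * D\<^sup>2 * ((3 - \<nu>) * \<Lambda> + L 0 \<omega> + 2 / D * sqrt (V \<omega>))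
      - C \<omega> + D * sqrt (T \<omega>)) / real m" for \<omega>

  have pathwise: "Gap Q g (w_hat \<omega>) \<le> R \<omega>" if \<omega>: "\<omega> \<in> space P" for \<omega>
  proof -
    have "(norm (a - b))\<^sup>2 \<le> 2 * ((norm a)\<^sup>2 + (norm b)\<^sup>2)" for a b :: "real ^ 'n"
      using zero_le_power2[of "norm (a + b)"]
      by (simp add: power2_norm_eq_inner algebra_simps inner_commute)
    hence "sqrt (\<Sum>j<m. (norm (\<Delta>w j \<omega> - \<Delta>z j \<omega>))\<^sup>2) \<le> sqrt (V \<omega>)"
      unfolding V_def by (intro real_sqrt_le_mono sum_mono)
    moreover have "L m \<omega> \<le> (3 - \<nu>) * \<Lambda> + L 0 \<omega>
        + 2 / D * sqrt (\<Sum>j<m. (norm (\<Delta>w j \<omega> - \<Delta>z j \<omega>))\<^sup>2)"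
      unfolding \<Lambda>_def \<Delta>w_def \<Delta>z_def
      using ump_path.step_size_le[OF path[OF \<omega>] \<open>hoelder_on Q \<nu> L\<^sub>\<nu> g\<close> \<open>0 < \<nu>\<close> \<open>\<nu> < 1\<close> m(1)] .
    ultimately have "L m \<omega> \<le> (3 - \<nu>) * \<Lambda> + L 0 \<omega> + 2 / D * sqrt (V \<omega>)"
      using \<open>0 < D\<close> by (smt (verit) mult_left_mono divide_nonneg_pos)
    hence "3 / 2 * D\<^sup>2 * L m \<omega> \<le> 3 / 2 * D\<^sup>2 * ((3 - \<nu>) * \<Lambda> + L 0 \<omega> + 2 / D * sqrt (V \<omega>))"
      by (rule mult_left_mono) simp
    moreover have "w_hat \<omega> = (1 / real m) *\<^sub>R (\<Sum>j<m. w j \<omega>)"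
      by (simp add: w_hat_def m_def lessThan_Suc_atMost add.commute)
    moreover have "Gap Q g ((1 / real m) *\<^sub>R (\<Sum>j<m. w j \<omega>))
        \<le> (3 / 2 * D\<^sup>2 * L m \<omega> - C \<omega> + D * norm (\<Sum>j<m. \<Delta>w j \<omega>)) / real m"
      unfolding C_def \<Delta>w_def
      using \<open>monotone_operator_on Q g\<close> wQ[OF \<omega>] z0(1) m(1) assms(4)
        ump_path.surrogate_regret_le[OF path[OF \<omega>]]
      by (rule gap_average_le)
    ultimately show ?thesis
      unfolding R_def T_def by (simp add: divide_right_mono order_trans)
  qed

  have gap_int: "integrable P (\<lambda>\<omega>. Gap Q g (w_hat \<omega>))"
  proof -
    have gap: "continuous_on UNIV (Gap Q g)"
      using continuous_on_Gap[OF \<open>compact Q\<close> _ cont] z0(1) by auto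
    obtain B where B: "\<And>x. x \<in> Q \<Longrightarrow> norm (Gap Q g x) \<le> B"
      using compact_imp_bounded[OF compact_continuous_image[OF continuous_on_subset[OF gap] \<open>compact Q\<close>]]
      by (auto simp: bounded_iff)
    have "w_hat \<omega> \<in> Q" if "\<omega> \<in> space P" for \<omega>
      unfolding w_hat_def scaleR_sum_right
      using \<open>convex Q\<close> wQ[OF that] by (intro convex_sum) (auto simp: field_simps)
    moreover have "w_hat \<in> borel_measurable P"
      unfolding w_hat_def using measurable_history_imp[OF wm] by measurable
    hence "(\<lambda>\<omega>. Gap Q g (w_hat \<omega>)) \<in> borel_measurable P"
      using borel_measurable_continuous_onI[OF gap] by measurable
    ultimately show ?thesis
      using B by (intro integrable_const_bound[of _ B]) auto
  qed

  have V: "integrable P V" "expectation V \<le> (2 * \<sigma> * sqrt (real m))\<^sup>2"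
  proof -
    note w2 = noise_second_moment[OF wm wQ, folded \<Delta>w_def]
      and z2 = noise_second_moment[OF zm zQ, folded \<Delta>z_def]
    show "integrable P V"
      unfolding V_def using w2(1) z2(1) by simp
    have "expectation V = (\<Sum>j<m. 2 * (expectation (\<lambda>\<omega>. (norm (\<Delta>w j \<omega>))\<^sup>2)
        + expectation (\<lambda>\<omega>. (norm (\<Delta>z j \<omega>))\<^sup>2)))"
      unfolding V_def using w2(1) z2(1) by simp
    also have "\<dots> \<le> (\<Sum>j<m. 2 * (\<sigma>\<^sup>2 + \<sigma>\<^sup>2))"
      using w2(2) z2(2) by (intro sum_mono mult_left_mono add_mono) auto
    finally show "expectation V \<le> (2 * \<sigma> * sqrt (real m))\<^sup>2"
      by (simp add: power_mult_distrib algebra_simps)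
  qed
  have T: "integrable P T" "expectation T \<le> (\<sigma> * sqrt (real m))\<^sup>2"
    unfolding T_def \<Delta>w_def using noise_sum_second_moment[of "\<lambda>j. 2 * j + 1" w m] wm wQ
    by (simp_all add: strict_mono_def power_mult_distrib mult.commute)
  have C: "integrable P C" "expectation C = 0"
  proof -
    have past: "(\<lambda>\<omega>. w j \<omega> - z\<^sub>0) \<in> borel_measurable (history (2 * j + 1))" for j
      using wm by simp
    have sq: "integrable P (\<lambda>\<omega>. (norm (w j \<omega> - z\<^sub>0))\<^sup>2)" for j
      using measurable_history_imp[OF wm] wQ z0(1) assms(4)
      by (intro integrable_const_bound[of _ "D\<^sup>2"]) (auto intro!: AE_I2 power_mono)
    note orthogonal = noise_orthogonal_to_past[OF wm wQ past sq, folded \<Delta>w_def]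
    show "integrable P C" "expectation C = 0"
      unfolding C_def using orthogonal by simp_all
  qed
  have L0_int: "integrable P (L 0)"
  proof -
    have "integrable (distr P S (\<xi> 0)) (\<lambda>y. norm (G z\<^sub>0 y))"
      using iid unbiased z0(1) by (simp add: iid_samples_def unbiased_stochastic_operator_def)
    hence "integrable P (\<lambda>\<omega>. norm (G z\<^sub>0 (\<xi> 0 \<omega>)))"
      by (rule integrable_distr[OF sample_measurable])
    thus ?thesis
      by (simp add: L0 cong: Bochner_Integration.integrable_cong)
  qed
  have L0_nonneg: "0 \<le> expectation (L 0)"
    using L0 by (intro Bochner_Integration.integral_nonneg_AE AE_I2) simp
  have V_nonneg: "0 \<le> V \<omega>" and T_nonneg: "0 \<le> T \<omega>" for \<omega>
    by (simp_all add: V_def T_def sum_nonneg)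
  have c: "0 < 2 * \<sigma> * sqrt (real m)" "0 < \<sigma> * sqrt (real m)"
    using \<open>0 < \<sigma>\<close> m(1) by simp_all
  note sqrt_V = expectation_sqrt_le[OF V(1) V_nonneg V(2) c(1)]
    and sqrt_T = expectation_sqrt_le[OF T(1) T_nonneg T(2) c(2)]

  have R_int: "integrable P R"
    unfolding R_def using L0_int sqrt_V(1) sqrt_T(1) C(1) by simp
  have "expectation (\<lambda>\<omega>. Gap Q g (w_hat \<omega>)) \<le> expectation R"
    by (intro integral_mono gap_int R_int pathwise)
  also have "expectation R = (3 / 2 * D\<^sup>2 * ((3 - \<nu>) * \<Lambda> + expectation (L 0)
      + 2 / D * expectation (\<lambda>\<omega>. sqrt (V \<omega>))) + D * expectation (\<lambda>\<omega>. sqrt (T \<omega>))) / real m"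
    unfolding R_def using L0_int sqrt_V(1) sqrt_T(1) C by (simp add: prob_space)
  also have "\<dots> \<le> (3 / 2 * D\<^sup>2 * ((3 - \<nu>) * \<Lambda> + expectation (L 0)
      + 2 / D * (2 * \<sigma> * sqrt (real m))) + D * (\<sigma> * sqrt (real m))) / real m"
    using sqrt_V(2) sqrt_T(2) \<open>0 < D\<close>
    by (intro divide_right_mono add_mono mult_left_mono order_refl) auto
  \<comment> \<open>The factor 7 collects 6 from the growth of \<open>L\<close> and 1 from the noise sum.\<close>
  also have "\<dots> = 3 / 2 * (D\<^sup>2 / real m) * ((3 - \<nu>) * \<Lambda>) + 7 * D * \<sigma> * sqrt (real m) / real m
      + 3 / 2 * D\<^sup>2 * expectation (L 0) / real m"
    using \<open>0 < D\<close> m(1) by (simp add: field_simps power2_eq_square)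
  also have "\<dots> \<le> 32 * (D\<^sup>2 / (8 * real k)) powr ((1 + \<nu>) / 2) * L\<^sub>\<nu>
      + 32 * D / sqrt (8 * real k) * \<sigma> + 2 * D\<^sup>2 * expectation (L 0) / real k"
  proof (intro add_mono)
    show "3 / 2 * (D\<^sup>2 / real m) * ((3 - \<nu>) * \<Lambda>)
        \<le> 32 * (D\<^sup>2 / (8 * real k)) powr ((1 + \<nu>) / 2) * L\<^sub>\<nu>"
      unfolding \<Lambda>_def m(2) using assms(3,8-10,16)
      by (intro hoelder_rate_le) (auto simp: hoelder_on_def)
    show "7 * D * \<sigma> * sqrt (real m) / real m \<le> 32 * D / sqrt (8 * real k) * \<sigma>"
      unfolding m(2) using assms(3,11,16) by (rule noise_rate_le)
    show "3 / 2 * D\<^sup>2 * expectation (L 0) / real m \<le> 2 * D\<^sup>2 * expectation (L 0) / real k"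
      using L0_nonneg \<open>1 \<le> k\<close> m(2) by (intro frac_le mult_right_mono) auto
  qed
  finally show ?thesis
    using gap_int by blast
qed

end
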